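(* Let $\mathbf F=\{F_\gamma:\gamma\in T^*\}$ be a weight system for the cascade generator $\{W_\gamma:\gamma\in T^*\}$ on $(\Omega,\mathcal F,P)$, with $Z_\emptyset=E_P[W_\emptyset F_\emptyset]>0$, and let $\mathcal Q_{\mathbf F}$ be the associated probability on $\Omega\times T$. Then $$\mathcal Q_{\mathbf F}(d\omega,dt)=P_{\mathbf F,t}(d\omega)\,\lambda(dt),$$ where, for each $t\in T$, $P_{\mathbf F,t}$ is the probability on $(\Omega,\mathcal F)$ determined by $$\frac{dP_{\mathbf F,t}}{dP}\Big|_{\mathcal F_n}=Z_\emptyset^{-1}\Big(\prod_{j=0}^nW_{t|j}\Big)F_{t|n},\qquad n\ge0.$$
   Context: Tree. Fix an integer $b\ge2$. $T=\{0,\dots,b-1\}^{\mathbb N}$ with the product topology (a compact metric space) and Borel $\sigma$-field $\mathcal B(T)$; $\lambda$ is the normalized Haar measure on $T$ (the product of uniform measures). $T^*$ is the set of all finite words over $\{0,\dots,b-1\}$, including the empty word $\emptyset$ (the root). $|\gamma|$ is the length of $\gamma\in T^*$. For $t\in T$, $t|n=(t_1,\dots,t_n)$, $t|0=\emptyset$; for $\gamma\in T^*$ and $j\le|\gamma|$, $\gamma|j$ is the prefix of length $j$. Cascade generator. Given a probability measure $p_0(dx)$ on $[0,\infty)$ and transition probability kernels $q_n(dx|x_0,\dots,x_{n-1})$, $n\ge1$, on $[0,\infty)$, each of mean one ($\int x\,q_n(dx|x_0,\dots,x_{n-1})=1$), let $\Omega=[0,\infty)^{T^*}$ with product $\sigma$-field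 $\mathcal F$, let $W_\gamma(\omega)=\omega_\gamma$ and $\mathcal F_n=\sigma\{W_\gamma:|\gamma|\le n\}$, and let $P$ be the probability on $(\Omega,\mathcal F)$ such that: $W_\emptyset$ has law $p_0$; for every $t\in T$ and $n\ge0$ the conditional law of $W_{t|n+1}$ given $\mathcal F_n$ is $q_{n+1}(dx|W_{t|0},\dots,W_{t|n})$; and the variables $W_\gamma$, $|\gamma|=n+1$, are conditionally independent given $\mathcal F_n$. Positive $T$-martingale. A sequence $\{Q_n(t)\}$ of nonnegative functions on $T\times\Omega$ such that for every $t\in T$, $\{Q_n(t)\}_n$ is a martingale with respect to $(\mathcal F_n)$ under $P$, and for $P$-a.e. $\omega$ the functions $Q_n(\cdot,\omega)$ are Borel. Weight system. A family $\mathbf F=\{F_\gamma:\gamma\in T^*\}$ of functions $F_\gamma:\Omega\to[0,\infty)$ with $F_\gamma$ measurable with respect to $\sigma\{W_{\gamma|j}:0\le j\le|\gamma|\}$ and such that $$Q_{\mathbf F,n}(t)=\Big(\prod_{j=0}^nW_{t|j}\Big)F_{t|n},\qquad n\ge0,\ t\in T,$$ is a positive $T$-martingale. The probability $\mathcal Q_{\mathbf F}$. Put $Z_\emptyset=E_P[W_\emptyset F_\emptyset]$, assumed $>0$. $\mathcal Q_{\mathbf F}$ is the unique probability on $(\Omega\times T,\mathcal F\otimes\mathcal B(T))$ such that for each $n\ge0$ and each bounded $\mathcal F_n\otimes\mathcal B(T)$-measurable $f$, $$\int f\,d\mathcal Q_{\mathbf F}=Z_\emptyset^{-1}E_P\int_Tf(\omega,t)Q_{\mathbf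 F,n}(t)\,\lambda(dt).$$ *)

theory Defs
  imports "HOL-Probability.Probability"
begin

section \<open>The tree and its boundary\<close>

text \<open>The finite words are the lists over \<open>{..<b}\<close>; a point of the boundary is a sequence
  \<open>t :: nat \<Rightarrow> nat\<close> indexed from 0, so that the usual \<open>t\<^sub>1, t\<^sub>2, \<dots>\<close> are \<open>t 0, t 1, \<dots>\<close>.\<close>

definition words :: "nat \<Rightarrow> nat list set" where
  "words b = lists {..<b}"

definition restr :: "(nat \<Rightarrow> nat) \<Rightarrow> nat \<Rightarrow> nat list" where
  "restr t n = map t [0..<n]"

text \<open>The boundary with its normalized Haar measure. The measurable space underlying it is a
  product \<open>\<sigma>\<close>-field; lemma \<open>sets_haar_eq_borel\<close> below identifies it with
  the Borel \<open>\<sigma>\<close>-field of the product topology.\<close>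

definition haar :: "nat \<Rightarrow> (nat \<Rightarrow> nat) measure" where
  "haar b = PiM UNIV (\<lambda>_. uniform_count_measure {..<b})"

definition boundary_topology :: "nat \<Rightarrow> (nat \<Rightarrow> nat) topology" where
  "boundary_topology b = product_topology (\<lambda>_. discrete_topology {..<b}) UNIV"

lemma space_haar: "space (haar b) = (UNIV \<rightarrow>\<^sub>E {..<b})"
  by (simp add: haar_def space_PiM space_uniform_count_measure)

lemma topspace_boundary: "topspace (boundary_topology b) = space (haar b)"
  by (simp add: boundary_topology_def space_haar)

lemma restr_in_words: "t \<in> space (haar b) \<Longrightarrow> restr t n \<in> words b"
  by (auto simp: space_haar restr_def words_def PiE_iff)

lemma sets_haar_eq_borel:
  "sets (haar b) = sigma_sets (topspace (boundary_topology b)) {U. openin (boundary_topology b) U}"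
proof
  let ?T = "UNIV \<rightarrow>\<^sub>E {..<b} :: (nat \<Rightarrow> nat) set"
  let ?G = "{U. openin (boundary_topology b) U}"
  have topT: "topspace (boundary_topology b) = ?T"
    by (simp add: topspace_boundary space_haar)
  have G: "?G \<subseteq> Pow ?T"
    using openin_subset topT by fastforce
  have sets_eq: "sets (haar b) =
      sigma_sets ?T {{f \<in> ?T. f i \<in> A} | i A. A \<subseteq> {..<b}}"
    unfolding haar_def sets_PiM_single
    by (simp add: sets_uniform_count_measure space_uniform_count_measure)
  show "sets (haar b) \<subseteq> sigma_sets (topspace (boundary_topology b)) ?G"
    unfolding sets_eq topT
  proof (rule sigma_sets_mono, clarify)
    fix i A assume "A \<subseteq> {..<b}"
    then have "openin (boundary_topology b) {f \<in> ?T. f i \<in> A}"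
      using openin_continuous_map_preimage[OF continuous_map_product_projection, of i UNIV
          "\<lambda>_. discrete_topology {..<b}" A]
      by (simp add: boundary_topology_def)
    then show "{f \<in> ?T. f i \<in> A} \<in> sigma_sets ?T ?G"
      by (intro sigma_sets.Basic) simp
  qed
  let ?cyl = "\<lambda>w. {f \<in> ?T. restr f (length w) = w}"
  have cyl: "?cyl w \<in> sets (haar b)" for w
  proof -
    have "restr f (length w) = w \<longleftrightarrow> (\<forall>i<length w. f i = w ! i)" for f
      by (subst list_eq_iff_nth_eq) (simp add: restr_def)
    then have "?cyl w = {f \<in> space (haar b). \<forall>i<length w. f i = w ! i}"
      by (simp add: space_haar)
    also have "\<dots> \<in> sets (haar b)"
    proof (rule sets.sets_Collect_countable_All)
      fix i
      have "{f \<in> ?T. f i \<in> {w ! i} \<inter> {..<b}} \<in> sets (haar b)"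
        unfolding sets_eq by (rule sigma_sets.Basic) blast
      moreover have "{f \<in> ?T. f i \<in> {w ! i} \<inter> {..<b}} = {f \<in> space (haar b). f i = w ! i}"
        by (auto simp: space_haar PiE_iff)
      ultimately show "{f \<in> space (haar b). i < length w \<longrightarrow> f i = w ! i} \<in> sets (haar b)"
        by (cases "i < length w") auto
    qed
    finally show ?thesis .
  qed
  show "sigma_sets (topspace (boundary_topology b)) ?G \<subseteq> sets (haar b)"
    unfolding topspace_boundary
  proof (rule sets.sigma_sets_subset, clarify)
    fix U assume U: "openin (boundary_topology b) U"
    have "U = (\<Union>w\<in>{w. ?cyl w \<subseteq> U}. ?cyl w)"
    proof (intro equalityI subsetI)
      fix x assume x: "x \<in> U"
      then have xT: "x \<in> ?T"
        using U openin_subset topT by blast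
      obtain V where fin: "finite {i. V i \<noteq> {..<b}}" and xV: "x \<in> Pi\<^sub>E UNIV V"
        and VU: "Pi\<^sub>E UNIV V \<subseteq> U"
        using U x unfolding boundary_topology_def openin_product_topology_alt by auto
      obtain n where n: "\<And>i. V i \<noteq> {..<b} \<Longrightarrow> i < n"
        using fin unfolding finite_nat_set_iff_bounded by auto
      have "?cyl (restr x n) \<subseteq> U"
      proof
        fix y assume y: "y \<in> ?cyl (restr x n)"
        then have eq: "y i = x i" if "i < n" for i
          using that by (auto simp: restr_def)
        have "y i \<in> V i" for i
          using n[of i] eq[of i] xV y by (cases "i < n") (auto simp: PiE_iff)
        then show "y \<in> U"
          using VU by (auto simp: PiE_iff)
      qed
      moreover have "x \<in> ?cyl (restr x n)"
        using xT by (simp add: restr_def)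
      ultimately show "x \<in> (\<Union>w\<in>{w. ?cyl w \<subseteq> U}. ?cyl w)"
        by blast
    qed blast
    also have "\<dots> \<in> sets (haar b)"
      using cyl by (intro sets.countable_UN'') auto
    finally show "U \<in> sets (haar b)" .
  qed
qed


section \<open>Cascade generators\<close>

definition half_line :: "real measure" where
  "half_line = restrict_space borel {0..}"

definition weight_space :: "nat \<Rightarrow> (nat list \<Rightarrow> real) measure" where
  "weight_space b = PiM (words b) (\<lambda>_. half_line)"

text \<open>The \<open>\<sigma>\<close>-field \<open>\<sigma>{W\<^sub>\<gamma> : \<gamma> \<in> I}\<close> on \<open>\<Omega>\<close>, where \<open>W\<^sub>\<gamma>(\<omega>) = \<omega> \<gamma>\<close>.
  Only the sets of this measure space matter.\<close>

definition coord_algebra :: "nat \<Rightarrow> nat list set \<Rightarrow> (nat list \<Rightarrow> real) measure" where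
  "coord_algebra b I = sigma (space (weight_space b))
     {(\<lambda>\<omega>. \<omega> \<gamma>) -` B \<inter> space (weight_space b) | \<gamma> B. \<gamma> \<in> I \<and> B \<in> sets half_line}"

definition level_algebra :: "nat \<Rightarrow> nat \<Rightarrow> (nat list \<Rightarrow> real) measure" where
  "level_algebra b n = coord_algebra b {\<gamma> \<in> words b. length \<gamma> \<le> n}"

definition path_algebra :: "nat \<Rightarrow> nat list \<Rightarrow> (nat list \<Rightarrow> real) measure" where
  "path_algebra b \<gamma> = coord_algebra b {take j \<gamma> | j. j \<le> length \<gamma>}"

definition cond_indep_vars ::
    "'a measure \<Rightarrow> 'a measure \<Rightarrow> 'c measure \<Rightarrow> ('i \<Rightarrow> 'a \<Rightarrow> 'c) \<Rightarrow> 'i set \<Rightarrow> bool" where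
  "cond_indep_vars M G N X I \<longleftrightarrow>
     (\<forall>i\<in>I. X i \<in> measurable M N) \<and>
     (\<forall>J\<subseteq>I. finite J \<longrightarrow> J \<noteq> {} \<longrightarrow> (\<forall>B\<in>Pi J (\<lambda>_. sets N).
        AE \<omega> in M.
          real_cond_exp M G (indicator {\<omega>' \<in> space M. \<forall>i\<in>J. X i \<omega>' \<in> B i}) \<omega> =
          (\<Prod>i\<in>J. real_cond_exp M G (indicator {\<omega>' \<in> space M. X i \<omega>' \<in> B i}) \<omega>)))"

text \<open>The kernel \<open>q n\<close>, for \<open>n \<ge> 1\<close>, takes the history \<open>(x\<^sub>0, \<dots>, x\<^sub>n\<^sub>-\<^sub>1)\<close> as an
  extensional function on \<open>{..<n}\<close>; the value \<open>q 0\<close> is irrelevant.\<close>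

definition cascade_kernels ::
    "real measure \<Rightarrow> (nat \<Rightarrow> (nat \<Rightarrow> real) \<Rightarrow> real measure) \<Rightarrow> bool" where
  "cascade_kernels p0 q \<longleftrightarrow>
     p0 \<in> space (prob_algebra half_line) \<and>
     (\<forall>n\<ge>1. q n \<in> measurable (PiM {..<n} (\<lambda>_. half_line)) (prob_algebra half_line) \<and>
        (\<forall>x\<in>space (PiM {..<n} (\<lambda>_. half_line)). has_bochner_integral (q n x) (\<lambda>y. y) 1))"

definition cascade_generator ::
    "nat \<Rightarrow> real measure \<Rightarrow> (nat \<Rightarrow> (nat \<Rightarrow> real) \<Rightarrow> real measure) \<Rightarrow>
     (nat list \<Rightarrow> real) measure \<Rightarrow> bool" where
  "cascade_generator b p0 q P \<longleftrightarrow>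
     cascade_kernels p0 q \<and>
     prob_space P \<and> sets P = sets (weight_space b) \<and>
     distr P half_line (\<lambda>\<omega>. \<omega> []) = p0 \<and>
     (\<forall>t\<in>space (haar b). \<forall>n. \<forall>B\<in>sets half_line.
        AE \<omega> in P.
          real_cond_exp P (level_algebra b n)
            (indicator {\<omega>' \<in> space P. \<omega>' (restr t (Suc n)) \<in> B}) \<omega> =
          measure (q (Suc n) (\<lambda>i\<in>{..<Suc n}. \<omega> (restr t i))) B) \<and>
     (\<forall>n. cond_indep_vars P (level_algebra b n) half_line (\<lambda>\<gamma> \<omega>. \<omega> \<gamma>)
            {\<gamma> \<in> words b. length \<gamma> = Suc n})"


section \<open>Weight systems\<close>

definition martingale :: "'a measure \<Rightarrow> (nat \<Rightarrow> 'a measure) \<Rightarrow> (nat \<Rightarrow> 'a \<Rightarrow> real) \<Rightarrow> bool" where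
  "martingale M G X \<longleftrightarrow>
     (\<forall>n. X n \<in> borel_measurable (G n) \<and> integrable M (X n)) \<and>
     (\<forall>m n. m \<le> n \<longrightarrow> (AE \<omega> in M. real_cond_exp M (G m) (X n) \<omega> = X m \<omega>))"

definition positive_T_martingale ::
    "nat \<Rightarrow> (nat list \<Rightarrow> real) measure \<Rightarrow>
     (nat \<Rightarrow> (nat \<Rightarrow> nat) \<Rightarrow> (nat list \<Rightarrow> real) \<Rightarrow> real) \<Rightarrow> bool" where
  "positive_T_martingale b P Q \<longleftrightarrow>
     (\<forall>n. \<forall>t\<in>space (haar b). \<forall>\<omega>\<in>space P. 0 \<le> Q n t \<omega>) \<and>
     (\<forall>t\<in>space (haar b). martingale P (level_algebra b) (\<lambda>n. Q n t)) \<and>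
     (AE \<omega> in P. \<forall>n. (\<lambda>t. Q n t \<omega>) \<in> borel_measurable (haar b))"

definition weight_density ::
    "(nat list \<Rightarrow> (nat list \<Rightarrow> real) \<Rightarrow> real) \<Rightarrow> nat \<Rightarrow> (nat \<Rightarrow> nat) \<Rightarrow> (nat list \<Rightarrow> real) \<Rightarrow> real" where
  "weight_density F n t \<omega> = (\<Prod>j\<le>n. \<omega> (restr t j)) * F (restr t n) \<omega>"

definition weight_system ::
    "nat \<Rightarrow> (nat list \<Rightarrow> real) measure \<Rightarrow> (nat list \<Rightarrow> (nat list \<Rightarrow> real) \<Rightarrow> real) \<Rightarrow> bool" where
  "weight_system b P F \<longleftrightarrow>
     (\<forall>\<gamma>\<in>words b. F \<gamma> \<in> measurable (path_algebra b \<gamma>) half_line) \<and>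
     positive_T_martingale b P (weight_density F)"

definition root_mass ::
    "(nat list \<Rightarrow> real) measure \<Rightarrow> (nat list \<Rightarrow> (nat list \<Rightarrow> real) \<Rightarrow> real) \<Rightarrow> real" where
  "root_mass P F = (\<integral>\<omega>. \<omega> [] * F [] \<omega> \<partial>P)"


section \<open>The probabilities on \<open>\<Omega> \<times> T\<close> and on \<open>\<Omega>\<close>\<close>

definition is_weighted_measure ::
    "nat \<Rightarrow> (nat list \<Rightarrow> real) measure \<Rightarrow> (nat list \<Rightarrow> (nat list \<Rightarrow> real) \<Rightarrow> real) \<Rightarrow>
     ((nat list \<Rightarrow> real) \<times> (nat \<Rightarrow> nat)) measure \<Rightarrow> bool" where
  "is_weighted_measure b P F \<Q> \<longleftrightarrow>
     prob_space \<Q> \<and> sets \<Q> = sets (weight_space b \<Otimes>\<^sub>M haar b) \<and>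
     (\<forall>n. \<forall>f \<in> borel_measurable (level_algebra b n \<Otimes>\<^sub>M haar b).
        (\<exists>C. \<forall>z\<in>space (weight_space b \<Otimes>\<^sub>M haar b). \<bar>f z\<bar> \<le> C) \<longrightarrow>
        (\<integral>z. f z \<partial>\<Q>) =
        inverse (root_mass P F) *
          (\<integral>\<omega>. (\<integral>t. f (\<omega>, t) * weight_density F n t \<omega> \<partial>haar b) \<partial>P))"

text \<open>\<open>dR/dP\<close> restricted to \<open>\<F>\<^sub>n\<close> equals \<open>g n\<close>, for every \<open>n\<close>.\<close>

definition has_level_densities ::
    "nat \<Rightarrow> (nat list \<Rightarrow> real) measure \<Rightarrow> (nat list \<Rightarrow> real) measure \<Rightarrow>
     (nat \<Rightarrow> (nat list \<Rightarrow> real) \<Rightarrow> real) \<Rightarrow> bool" where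
  "has_level_densities b P R g \<longleftrightarrow>
     (\<forall>n. restr_to_subalg R (level_algebra b n) =
          density (restr_to_subalg P (level_algebra b n)) (\<lambda>\<omega>. ennreal (g n \<omega>)))"

definition is_tilted_measure ::
    "nat \<Rightarrow> (nat list \<Rightarrow> real) measure \<Rightarrow> (nat list \<Rightarrow> (nat list \<Rightarrow> real) \<Rightarrow> real) \<Rightarrow>
     (nat \<Rightarrow> nat) \<Rightarrow> (nat list \<Rightarrow> real) measure \<Rightarrow> bool" where
  "is_tilted_measure b P F t R \<longleftrightarrow>
     prob_space R \<and> sets R = sets (weight_space b) \<and>
     has_level_densities b P R (\<lambda>n \<omega>. inverse (root_mass P F) * weight_density F n t \<omega>)"

definition tilted_measure ::
    "nat \<Rightarrow> (nat list \<Rightarrow> real) measure \<Rightarrow> (nat list \<Rightarrow> (nat list \<Rightarrow> real) \<Rightarrow> real) \<Rightarrow>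
     (nat \<Rightarrow> nat) \<Rightarrow> (nat list \<Rightarrow> real) measure" where
  "tilted_measure b P F t = (THE R. is_tilted_measure b P F t R)"

text \<open>\<open>\<Q>(d\<omega>, dt) = K\<^sub>t(d\<omega>) \<mu>(dt)\<close> for a probability kernel \<open>K\<close> from the space of \<open>\<mu>\<close> to \<open>N\<close>.\<close>

definition disintegrates ::
    "('a \<times> 'b) measure \<Rightarrow> 'a measure \<Rightarrow> ('b \<Rightarrow> 'a measure) \<Rightarrow> 'b measure \<Rightarrow> bool" where
  "disintegrates \<Q> N K \<mu> \<longleftrightarrow>
     K \<in> measurable \<mu> (prob_algebra N) \<and>
     sets \<Q> = sets (N \<Otimes>\<^sub>M \<mu>) \<and>
     (\<forall>A\<in>sets (N \<Otimes>\<^sub>M \<mu>).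
        emeasure \<Q> A = (\<integral>\<^sup>+t. emeasure (K t) {\<omega> \<in> space N. (\<omega>, t) \<in> A} \<partial>\<mu>))"

end

theory Submission
  imports Defs
begin

text \<open>
  Write \<open>Z\<close> for the root mass and \<open>Q\<^sub>n(t)\<close> for the weight density at level \<open>n\<close>.

  For a fixed boundary point \<open>t\<close>, the measures \<open>Z\<inverse> Q\<^sub>n(t) dP\<close> are probabilities, and the martingale
  property says precisely that the \<open>n\<close>-th and the \<open>m\<close>-th agree on \<open>\<F>\<^sub>m\<close> when \<open>m \<le> n\<close>. A level consists
  of finitely many vertices, so such a consistent sequence prescribes consistent laws for all finite
  families of the coordinates \<open>W\<^sub>\<gamma>\<close>, and Kolmogorov's extension theorem yields the tilted measure
  (\<open>level_consistent_extension\<close>). The martingale alone would not suffice: it need not be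
  uniformly integrable, so the tilted measure may be singular to \<open>P\<close>, and countable additivity
  has to come from the topology of the state space. Uniqueness holds since the sets of \<open>\<Union>\<^sub>n \<F>\<^sub>n\<close>
  form a \<open>\<pi>\<close>-system that generates \<open>\<F>\<close>.

  For the disintegration it is enough to compare both sides on rectangles \<open>A \<times> B\<close> with \<open>A \<in> \<F>\<^sub>n\<close>.
  The density \<open>Q\<^sub>n(t)\<close> depends on \<open>t\<close> only through the word \<open>t|n\<close>, of which there are finitely many.
  Hence \<open>t \<mapsto> P\<^sub>F\<^sub>,\<^sub>t(A)\<close> is a step function constant on cylinders. This makes the kernel measurable,
  and it turns the exchange of the integrals over \<open>\<Omega>\<close> and over the boundary, on which the equality
  of the two measures on \<open>A \<times> B\<close> rests (\<open>weighted_measure_rectangle\<close>), into the linearity of the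
  integral for finite sums.
\<close>

section \<open>The coordinates up to a level\<close>

definition level_words :: "nat \<Rightarrow> nat \<Rightarrow> nat list set" where
  "level_words b n = {\<gamma> \<in> words b. length \<gamma> \<le> n}"

lemma finite_level_words: "finite (level_words b n)"
  unfolding level_words_def words_def
  by (rule finite_subset[OF _ finite_lists_length_le[of "{..<b}" n]]) auto

lemma finite_subset_level_words:
  assumes "finite J" "J \<subseteq> words b"
  shows "\<exists>n. J \<subseteq> level_words b n"
proof -
  have "length \<gamma> \<le> Max (insert 0 (length ` J))" if "\<gamma> \<in> J" for \<gamma>
    using assms that by (intro Max_ge) auto
  then have "J \<subseteq> level_words b (Max (insert 0 (length ` J)))"
    using assms(2) by (auto simp: level_words_def)
  then show ?thesis ..
qed

lemma space_coord_algebra: "space (coord_algebra b I) = space (weight_space b)"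
  unfolding coord_algebra_def by (rule space_measure_of) auto

lemma sets_coord_algebra:
  "sets (coord_algebra b I) = sigma_sets (space (weight_space b))
     {(\<lambda>\<omega>. \<omega> \<gamma>) -` B \<inter> space (weight_space b) | \<gamma> B. \<gamma> \<in> I \<and> B \<in> sets half_line}"
  unfolding coord_algebra_def by (rule sets_measure_of) auto

lemma coord_in_half_line:
  "\<omega> \<in> space (weight_space b) \<Longrightarrow> \<gamma> \<in> words b \<Longrightarrow> \<omega> \<gamma> \<in> space half_line"
  by (auto simp: weight_space_def space_PiM)

lemma coord_nonneg:
  "\<omega> \<in> space (weight_space b) \<Longrightarrow> \<gamma> \<in> words b \<Longrightarrow> 0 \<le> \<omega> \<gamma>"
  using coord_in_half_line by (auto simp: half_line_def space_restrict_space)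

lemma measurable_coord:
  assumes "\<gamma> \<in> I" "I \<subseteq> words b"
  shows "(\<lambda>\<omega>. \<omega> \<gamma>) \<in> measurable (coord_algebra b I) half_line"
  using assms coord_in_half_line
  by (intro measurableI) (fastforce simp: space_coord_algebra sets_coord_algebra)+

lemma space_level_algebra: "space (level_algebra b n) = space (weight_space b)"
  by (simp add: level_algebra_def space_coord_algebra)

lemma measurable_restrict_level:
  "J \<subseteq> level_words b n \<Longrightarrow>
    (\<lambda>\<omega>. restrict \<omega> J) \<in> measurable (level_algebra b n) (PiM J (\<lambda>_. half_line))"
  unfolding level_algebra_def level_words_def[symmetric]
  by (intro measurable_restrict measurable_coord) (auto simp: level_words_def)

lemma measurable_restrict_level_borel:
  assumes "J \<subseteq> level_words b n"
  shows "(\<lambda>\<omega>. restrict \<omega> J) \<in> measurable (level_algebra b n) (PiM J (\<lambda>_. borel :: real measure))"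
proof (rule measurable_restrict)
  fix \<gamma> assume "\<gamma> \<in> J"
  then have "(\<lambda>\<omega>. \<omega> \<gamma>) \<in> measurable (level_algebra b n) half_line"
    unfolding level_algebra_def level_words_def[symmetric] using assms
    by (intro measurable_coord) (auto simp: level_words_def)
  then show "(\<lambda>\<omega>. \<omega> \<gamma>) \<in> borel_measurable (level_algebra b n)"
    unfolding half_line_def measurable_restrict_space2_iff by simp
qed

text \<open>Membership in a set of \<open>\<F>\<^sub>n\<close> is decided by the finitely many coordinates up to level \<open>n\<close>. This
  is what lets the finite-dimensional distributions determine a measure on \<open>\<F>\<^sub>n\<close>.\<close>
lemma sets_level_algebra_finite_window:
  "sets (level_algebra b n) =
    {(\<lambda>\<omega>. restrict \<omega> (level_words b n)) -` B \<inter> space (weight_space b) |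
      B. B \<in> sets (PiM (level_words b n) (\<lambda>_. half_line))}" (is "_ = ?V")
proof
  let ?r = "\<lambda>\<omega>. restrict \<omega> (level_words b n)"
  let ?S = "space (weight_space b)" and ?N = "PiM (level_words b n) (\<lambda>_. half_line)"
  have r: "?r \<in> ?S \<rightarrow> space ?N"
    using measurable_space[OF measurable_restrict_level[of "level_words b n" b n]]
    by (auto simp: space_level_algebra)
  have V: "?V = sets (vimage_algebra ?S ?r ?N)"
    using sets_vimage_algebra2[OF r] by simp
  show "sets (level_algebra b n) \<subseteq> ?V"
    unfolding V unfolding level_algebra_def sets_coord_algebra level_words_def[symmetric]
  proof (rule sets.sigma_sets_subset', clarify)
    fix \<gamma> B assume g: "\<gamma> \<in> level_words b n" and B: "B \<in> sets half_line"
    have "(\<lambda>\<omega>. \<omega> \<gamma>) -` B \<inter> ?S = ?r -` ((\<lambda>\<omega>. \<omega> \<gamma>) -` B \<inter> space ?N) \<inter> ?S"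
      using r g by auto
    also have "\<dots> \<in> sets (vimage_algebra ?S ?r ?N)"
      by (intro in_vimage_algebra measurable_sets[OF measurable_component_singleton] g B)
    finally show "(\<lambda>\<omega>. \<omega> \<gamma>) -` B \<inter> ?S \<in> sets (vimage_algebra ?S ?r ?N)" .
  next
    show "?S \<in> sets (vimage_algebra ?S ?r ?N)"
      using sets.top[of "vimage_algebra ?S ?r ?N"] by simp
  qed
  show "?V \<subseteq> sets (level_algebra b n)"
    using measurable_sets[OF measurable_restrict_level[of "level_words b n" b n]]
    by (auto simp: space_level_algebra)
qed

lemma sets_level_subset_weight: "sets (level_algebra b n) \<subseteq> sets (weight_space b)"
  unfolding level_algebra_def sets_coord_algebra
proof (rule sets.sigma_sets_subset, clarify)
  fix \<gamma> B assume "\<gamma> \<in> words b" "B \<in> sets half_line"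
  then show "(\<lambda>\<omega>. \<omega> \<gamma>) -` B \<inter> space (weight_space b) \<in> sets (weight_space b)"
    unfolding weight_space_def by (intro measurable_sets[OF measurable_component_singleton])
qed

lemma sets_level_mono: "m \<le> n \<Longrightarrow> sets (level_algebra b m) \<subseteq> sets (level_algebra b n)"
  unfolding level_algebra_def sets_coord_algebra by (rule sigma_sets_mono') force

lemma sets_weight_generated:
  "sets (weight_space b) = sigma_sets (space (weight_space b)) (\<Union>n. sets (level_algebra b n))"
proof
  have "{{f \<in> space (weight_space b). f \<gamma> \<in> A} | \<gamma> A. \<gamma> \<in> words b \<and> A \<in> sets half_line}
      \<subseteq> (\<Union>n. sets (level_algebra b n))"
  proof clarify
    fix \<gamma> A assume "\<gamma> \<in> words b" "A \<in> sets half_line"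
    then have "(\<lambda>\<omega>. \<omega> \<gamma>) -` A \<inter> space (weight_space b) \<in> sets (level_algebra b (length \<gamma>))"
      unfolding level_algebra_def sets_coord_algebra by (intro sigma_sets.Basic) blast
    moreover have "(\<lambda>\<omega>. \<omega> \<gamma>) -` A \<inter> space (weight_space b) =
        {f \<in> space (weight_space b). f \<gamma> \<in> A}" by auto
    ultimately show "{f \<in> space (weight_space b). f \<gamma> \<in> A} \<in> (\<Union>n. sets (level_algebra b n))"
      by auto
  qed
  then show "sets (weight_space b) \<subseteq>
      sigma_sets (space (weight_space b)) (\<Union>n. sets (level_algebra b n))"
    unfolding weight_space_def sets_PiM_single space_PiM by (rule sigma_sets_mono')
  show "sigma_sets (space (weight_space b)) (\<Union>n. sets (level_algebra b n)) \<subseteq> sets (weight_space b)"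
    using sets_level_subset_weight by (intro sets.sigma_sets_subset) blast
qed

lemma Int_stable_levels: "Int_stable (\<Union>n. sets (level_algebra b n))"
proof (rule Int_stableI, clarify)
  fix A B m n assume "A \<in> sets (level_algebra b m)" "B \<in> sets (level_algebra b n)"
  then have "A \<in> sets (level_algebra b (max m n))" "B \<in> sets (level_algebra b (max m n))"
    using sets_level_mono[of m "max m n" b] sets_level_mono[of n "max m n" b] by auto
  then show "A \<inter> B \<in> (\<Union>n. sets (level_algebra b n))" by blast
qed

lemma levels_subset_Pow: "(\<Union>n. sets (level_algebra b n)) \<subseteq> Pow (space (weight_space b))"
  using sets_level_subset_weight sets.sets_into_space by blast

text \<open>The levels increase, so their union is closed under intersection, and it generates \<open>\<F>\<close>;
  hence agreement on every level is agreement everywhere.\<close>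
lemma measure_eqI_levels:
  assumes "prob_space R" "sets R = sets (weight_space b)" "sets R' = sets (weight_space b)"
    and eq: "\<And>n A. A \<in> sets (level_algebra b n) \<Longrightarrow> emeasure R A = emeasure R' A"
  shows "R = R'"
proof (rule measure_eqI_generator_eq[OF Int_stable_levels levels_subset_Pow])
  interpret prob_space R by fact
  show "range (\<lambda>_::nat. space (weight_space b)) \<subseteq> (\<Union>n. sets (level_algebra b n))"
    using sets.top[of "level_algebra b _"] by (auto simp: space_level_algebra)
  show "emeasure R (space (weight_space b)) \<noteq> \<infinity>" by simp
qed (use assms sets_weight_generated in auto)

section \<open>Extension of consistent measures on the levels\<close>

text \<open>The laws of finite families of coordinates, each computed under any \<open>\<nu> n\<close> whose level contains
  the family, are projective. Countable additivity of the limit comes from inner regularity of Borel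
  measures on a Polish space. The limit is formed with \<open>\<real>\<close> as state space and is then
  pushed forward under \<open>x \<mapsto> max 0 x\<close>. Since the marginals already live on nonnegative values,
  this map preserves them all, and the result is a measure on the right space without a
  separate proof that the limit charges only nonnegative families.\<close>
lemma level_consistent_extension:
  fixes \<nu> :: "nat \<Rightarrow> (nat list \<Rightarrow> real) measure"
  assumes prob: "\<And>n. prob_space (\<nu> n)"
    and sets_nu: "\<And>n. sets (\<nu> n) = sets (weight_space b)"
    and consistent: "\<And>m n A. m \<le> n \<Longrightarrow> A \<in> sets (level_algebra b m) \<Longrightarrow>
      emeasure (\<nu> n) A = emeasure (\<nu> m) A"
  shows "\<exists>!R. prob_space R \<and> sets R = sets (weight_space b) \<and>
    (\<forall>n. \<forall>A\<in>sets (level_algebra b n). emeasure R A = emeasure (\<nu> n) A)"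
proof (rule ex_ex1I)
  \<comment> \<open>The choice of the least level is immaterial: by \<open>marg_eq\<close> every level containing \<open>J\<close> gives
    the same marginal law.\<close>
  define lev where "lev J = (LEAST n. J \<subseteq> level_words b n)" for J
  define marg where
    "marg n J = distr (\<nu> n) (PiM J (\<lambda>_. borel :: real measure)) (\<lambda>\<omega>. restrict \<omega> J)" for n J
  have space_nu: "space (\<nu> n) = space (weight_space b)" for n
    using sets_nu by (rule sets_eq_imp_space_eq)
  have meas_nu: "(\<lambda>\<omega>. restrict \<omega> J) \<in> measurable (\<nu> k) (PiM J (\<lambda>_. borel))"
    if "J \<subseteq> level_words b n" for J n k
    using measurable_restrict_level_borel[OF that] sets_level_subset_weight[of b n]
    by (auto simp: measurable_def space_nu sets_nu space_level_algebra)
  have marg_eq: "marg n J = marg m J" if "J \<subseteq> level_words b m" "m \<le> n" for m n J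
  proof (rule measure_eqI)
    fix X assume "X \<in> sets (marg n J)"
    then have X: "X \<in> sets (PiM J (\<lambda>_. borel))" by (simp add: marg_def)
    have "(\<lambda>\<omega>. restrict \<omega> J) -` X \<inter> space (weight_space b) \<in> sets (level_algebra b m)"
      using measurable_sets[OF measurable_restrict_level_borel[OF that(1)] X]
      by (simp add: space_level_algebra)
    then show "emeasure (marg n J) X = emeasure (marg m J) X"
      using consistent[OF that(2)]
      by (simp add: marg_def emeasure_distr[OF meas_nu[OF that(1)] X] space_nu)
  qed (simp add: marg_def)
  have lev: "J \<subseteq> level_words b (lev J)" if "finite J" "J \<subseteq> words b" for J
    unfolding lev_def using LeastI_ex[OF finite_subset_level_words[OF that]] .
  have lev_le: "lev J \<le> n" if "J \<subseteq> level_words b n" for J n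
    unfolding lev_def using that by (rule Least_le)
  have marg_lev: "marg (lev J) J = marg n J"
    if "finite J" "J \<subseteq> words b" "J \<subseteq> level_words b n" for n J
    using marg_eq[OF lev[OF that(1,2)] lev_le[OF that(3)]] by simp
  interpret polish_projective "words b" "\<lambda>J. marg (lev J) J"
  proof (intro polish_projective.intro projective_family.intro)
    fix J H :: "nat list set" assume JH: "J \<subseteq> H" "finite H" "H \<subseteq> words b"
    then have J: "finite J" "J \<subseteq> words b" "J \<subseteq> level_words b (lev H)"
      using lev[of H] by (auto intro: finite_subset)
    have "distr (marg (lev H) H) (PiM J (\<lambda>_. borel)) (\<lambda>f. restrict f J) =
        distr (\<nu> (lev H)) (PiM J (\<lambda>_. borel)) ((\<lambda>f. restrict f J) \<circ> (\<lambda>\<omega>. restrict \<omega> H))"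
      unfolding marg_def
      by (rule distr_distr[OF measurable_restrict_subset[OF JH(1)] meas_nu[OF lev[OF JH(2,3)]]])
    also have "\<dots> = marg (lev H) J"
      using JH(1) unfolding marg_def by (intro distr_cong) (auto simp: restrict_def fun_eq_iff)
    finally show "marg (lev J) J = distr (marg (lev H) H) (PiM J (\<lambda>_. borel)) (\<lambda>f. restrict f J)"
      using marg_lev[OF J] by simp
  next
    fix J :: "nat list set" assume J: "finite J" "J \<subseteq> words b"
    show "prob_space (marg (lev J) J)"
      unfolding marg_def by (rule prob_space.prob_space_distr[OF prob meas_nu[OF lev[OF J]]])
  qed
  define clip :: "(nat list \<Rightarrow> real) \<Rightarrow> nat list \<Rightarrow> real" where
    "clip \<omega> = (\<lambda>\<gamma>\<in>words b. max 0 (\<omega> \<gamma>))" for \<omega>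
  have clip_window: "(\<lambda>x. \<lambda>\<gamma>\<in>J. max 0 (x \<gamma>)) \<in>
      measurable (PiM J (\<lambda>_. borel :: real measure)) (PiM J (\<lambda>_. half_line))" for J :: "nat list set"
    by (intro measurable_restrict) (auto simp: half_line_def intro!: measurable_restrict_space2)
  then have clip: "clip \<in> measurable lim (weight_space b)"
    unfolding clip_def weight_space_def by (simp cong: measurable_cong_sets)
  show "\<exists>R. prob_space R \<and> sets R = sets (weight_space b) \<and>
    (\<forall>n. \<forall>A\<in>sets (level_algebra b n). emeasure R A = emeasure (\<nu> n) A)"
  proof (intro exI conjI allI ballI)
    let ?R = "distr lim (weight_space b) clip"
    show "prob_space ?R" by (rule P.prob_space_distr[OF clip])
    show "sets ?R = sets (weight_space b)" by simp
    fix n A assume A: "A \<in> sets (level_algebra b n)"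
    let ?L = "level_words b n"
    obtain B where B: "B \<in> sets (PiM ?L (\<lambda>_. half_line))"
      and A_eq: "A = (\<lambda>\<omega>. restrict \<omega> ?L) -` B \<inter> space (weight_space b)"
      using A unfolding sets_level_algebra_finite_window by blast
    have L: "?L \<subseteq> words b" "finite ?L"
      using finite_level_words by (auto simp: level_words_def)
    define C where "C = (\<lambda>x. \<lambda>\<gamma>\<in>?L. max 0 (x \<gamma>)) -` B \<inter> space (PiM ?L (\<lambda>_. borel :: real measure))"
    have C: "C \<in> sets (PiM ?L (\<lambda>_. borel))"
      unfolding C_def by (rule measurable_sets[OF clip_window B])
    have "emeasure ?R A = emeasure lim (clip -` A \<inter> space lim)"
      using A sets_level_subset_weight by (intro emeasure_distr[OF clip]) blast
    also have "clip -` A \<inter> space lim = prod_emb (words b) (\<lambda>_. borel) ?L C"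
    proof -
      have "restrict (clip \<omega>) ?L = (\<lambda>\<gamma>\<in>?L. max 0 (restrict \<omega> ?L \<gamma>))" for \<omega>
        using L by (auto simp: clip_def restrict_def fun_eq_iff)
      then show ?thesis
        using measurable_space[OF clip] by (auto simp: A_eq C_def prod_emb_def space_PiM)
    qed
    also have "emeasure lim \<dots> = emeasure (marg n ?L) C"
      using emeasure_lim_emb[OF L C] marg_lev[OF L(2,1) order_refl] by simp
    also have "\<dots> = emeasure (\<nu> n) ((\<lambda>\<omega>. restrict \<omega> ?L) -` C \<inter> space (weight_space b))"
      unfolding marg_def by (simp add: emeasure_distr[OF meas_nu[OF order_refl] C] space_nu)
    also have "(\<lambda>\<omega>. restrict \<omega> ?L) -` C \<inter> space (weight_space b) = A"
    proof -
      have "(\<lambda>\<gamma>\<in>?L. max 0 (restrict \<omega> ?L \<gamma>)) = restrict \<omega> ?L" if "\<omega> \<in> space (weight_space b)" for \<omega>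
        using coord_nonneg[OF that] L by (auto simp: restrict_def fun_eq_iff max_def)
      then show ?thesis by (auto simp: A_eq C_def space_PiM)
    qed
    finally show "emeasure ?R A = emeasure (\<nu> n) A" .
  qed
next
  fix R R' assume "prob_space R \<and> sets R = sets (weight_space b) \<and>
      (\<forall>n. \<forall>A\<in>sets (level_algebra b n). emeasure R A = emeasure (\<nu> n) A)"
    and "prob_space R' \<and> sets R' = sets (weight_space b) \<and>
      (\<forall>n. \<forall>A\<in>sets (level_algebra b n). emeasure R' A = emeasure (\<nu> n) A)"
  then show "R = R'" by (intro measure_eqI_levels[of R b]) auto
qed

section \<open>Cylinders and rectangles\<close>

lemma restr_eq_iff: "restr t n = w \<longleftrightarrow> length w = n \<and> (\<forall>i<n. t i = w ! i)"
  by (auto simp: restr_def list_eq_iff_nth_eq)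

lemma measurable_restr: "(\<lambda>t. restr t n) \<in> measurable (haar b) (count_space UNIV)"
  unfolding measurable_count_space_eq_countable[OF countableI_type]
proof safe
  fix w :: "nat list"
  have coord: "(\<lambda>t. t i) \<in> measurable (haar b) (count_space {..<b})" for i
  proof -
    have "(\<lambda>t. t i) \<in> measurable (haar b) (uniform_count_measure {..<b})"
      unfolding haar_def by (rule measurable_component_singleton) simp
    also have "\<dots> = measurable (haar b) (count_space {..<b})"
      by (rule measurable_cong_sets) (simp_all add: sets_uniform_count_measure)
    finally show ?thesis .
  qed
  have "{t \<in> space (haar b). t i = k} \<in> sets (haar b)" for i k
  proof -
    have "(\<lambda>t. t i) -` ({k} \<inter> {..<b}) \<inter> space (haar b) \<in> sets (haar b)"
      by (rule measurable_sets[OF coord]) auto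
    also have "(\<lambda>t. t i) -` ({k} \<inter> {..<b}) \<inter> space (haar b) = {t \<in> space (haar b). t i = k}"
      using measurable_space[OF coord] by auto
    finally show ?thesis .
  qed
  then have "{t \<in> space (haar b). length w = n \<and> (\<forall>i\<in>{..<n}. t i = w ! i)} \<in> sets (haar b)"
    by (intro sets.sets_Collect_conj sets.sets_Collect_const sets.sets_Collect_finite_All) auto
  also have "{t \<in> space (haar b). length w = n \<and> (\<forall>i\<in>{..<n}. t i = w ! i)} =
      (\<lambda>t. restr t n) -` {w} \<inter> space (haar b)"
    using restr_eq_iff[of _ n w] by auto
  finally show "(\<lambda>t. restr t n) -` {w} \<inter> space (haar b) \<in> sets (haar b)" .
qed simp

lemma prob_space_haar: "b > 0 \<Longrightarrow> prob_space (haar b)"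
  unfolding haar_def by (intro prob_space_PiM prob_space_uniform_count_measure) auto

text \<open>The weight density as a function of the vertex alone: along all boundary points below the
  same vertex it is the same function of \<open>\<omega>\<close>.\<close>
definition path_density ::
    "(nat list \<Rightarrow> (nat list \<Rightarrow> real) \<Rightarrow> real) \<Rightarrow> nat list \<Rightarrow> (nat list \<Rightarrow> real) \<Rightarrow> real" where
  "path_density F w \<omega> = (\<Prod>j\<le>length w. \<omega> (take j w)) * F w \<omega>"

lemma weight_density_eq_path_density: "weight_density F n t = path_density F (restr t n)"
proof
  fix \<omega>
  have "take j (restr t n) = restr t j" if "j \<le> n" for j
    using that by (simp add: restr_def take_map)
  then show "weight_density F n t \<omega> = path_density F (restr t n) \<omega>"
    by (simp add: weight_density_def path_density_def) (simp add: restr_def)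
qed

definition words_of_length :: "nat \<Rightarrow> nat \<Rightarrow> nat list set" where
  "words_of_length b n = {w \<in> words b. length w = n}"

lemma finite_words_of_length: "finite (words_of_length b n)"
  by (rule finite_subset[OF _ finite_level_words[of b n]])
    (auto simp: words_of_length_def level_words_def)

lemma restr_in_words_of_length: "t \<in> space (haar b) \<Longrightarrow> restr t n \<in> words_of_length b n"
  using restr_in_words by (simp add: words_of_length_def) (simp add: restr_def)

text \<open>The hypotheses on a weight system speak of boundary points; every word lies on the path to
  one, so they carry over to words.\<close>
lemma word_is_restr:
  assumes "b > 0" "w \<in> words_of_length b n"
  shows "\<exists>t\<in>space (haar b). restr t n = w"
proof
  let ?t = "\<lambda>i. if i < n then w ! i else 0"
  show "restr ?t n = w" using assms by (auto simp: restr_eq_iff words_of_length_def)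
  show "?t \<in> space (haar b)"
    using assms by (auto simp: space_haar words_of_length_def words_def in_lists_conv_set)
qed

lemma sum_over_words_restr:
  fixes \<Phi> :: "nat list \<Rightarrow> real"
  assumes "t \<in> space (haar b)"
  shows "\<Phi> (restr t n) =
    (\<Sum>w\<in>words_of_length b n. \<Phi> w * indicator ((\<lambda>t. restr t n) -` {w} \<inter> space (haar b)) t)"
proof -
  have "(\<Sum>w\<in>words_of_length b n. \<Phi> w * indicator ((\<lambda>t. restr t n) -` {w} \<inter> space (haar b)) t) =
      (\<Sum>w\<in>words_of_length b n. if w = restr t n then \<Phi> w else 0)"
    using assms by (intro sum.cong) (auto simp: indicator_def)
  then show ?thesis
    using restr_in_words_of_length[OF assms] finite_words_of_length by simp
qed

text \<open>A function of \<open>t|n\<close> is a finite linear combination of cylinder indicators, hence integrable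
  whatever its values are; applied with \<open>\<Phi>\<close> depending on \<open>\<omega>\<close> and with \<open>\<Phi>\<close> integrated over \<open>\<omega>\<close>, this
  replaces Fubini's theorem.\<close>
lemma has_integral_over_cylinders:
  fixes \<Phi> :: "nat list \<Rightarrow> real"
  assumes "b > 0" "B \<in> sets (haar b)"
  shows "has_bochner_integral (haar b) (\<lambda>t. indicator B t * \<Phi> (restr t n))
    (\<Sum>w\<in>words_of_length b n. \<Phi> w * measure (haar b) (B \<inter> ((\<lambda>t. restr t n) -` {w} \<inter> space (haar b))))"
proof -
  interpret prob_space "haar b" using assms(1) by (rule prob_space_haar)
  let ?C = "\<lambda>w. (\<lambda>t. restr t n) -` {w} \<inter> space (haar b)"
  have C: "?C w \<in> sets (haar b)" for w
    by (rule measurable_sets[OF measurable_restr]) simp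
  have "has_bochner_integral (haar b) (\<lambda>t. \<Sum>w\<in>words_of_length b n. \<Phi> w * indicator (B \<inter> ?C w) t)
     (\<Sum>w\<in>words_of_length b n. \<Phi> w * measure (haar b) (B \<inter> ?C w))"
    by (intro has_bochner_integral_sum has_bochner_integral_mult_right
        has_bochner_integral_real_indicator sets.Int[OF assms(2) C]) (simp add: less_top[symmetric])
  moreover have "(\<Sum>w\<in>words_of_length b n. \<Phi> w * indicator (B \<inter> ?C w) t) =
      indicator B t * \<Phi> (restr t n)" if "t \<in> space (haar b)" for t
    using sum_over_words_restr[OF that, of \<Phi> n]
    by (simp add: sum_distrib_left indicator_inter_arith ac_simps)
  ultimately show ?thesis
    by (subst has_bochner_integral_cong[OF refl _ refl, symmetric]) auto
qed

lemma sets_pair_generated: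
  "sets (weight_space b \<Otimes>\<^sub>M haar b) = sigma_sets (space (weight_space b) \<times> space (haar b))
    {A \<times> B | A B. A \<in> (\<Union>n. sets (level_algebra b n)) \<and> B \<in> sets (haar b)}"
proof -
  have top: "space (weight_space b) \<in> (\<Union>n. sets (level_algebra b n))"
    using sets.top[of "level_algebra b _"] by (auto simp: space_level_algebra)
  have "sets (weight_space b \<Otimes>\<^sub>M haar b) = sets (sigma (space (weight_space b) \<times> space (haar b))
      {A \<times> B | A B. A \<in> (\<Union>n. sets (level_algebra b n)) \<and> B \<in> sets (haar b)})"
  proof (rule sets_pair_eq[OF levels_subset_Pow sets_weight_generated _ _ _ sets.space_closed
        sets.sigma_sets_eq[symmetric]])
    show "{space (weight_space b)} \<subseteq> (\<Union>n. sets (level_algebra b n))" using top by simp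
    show "{space (haar b)} \<subseteq> sets (haar b)" by simp
  qed auto
  also have "\<dots> = sigma_sets (space (weight_space b) \<times> space (haar b))
    {A \<times> B | A B. A \<in> (\<Union>n. sets (level_algebra b n)) \<and> B \<in> sets (haar b)}"
    using levels_subset_Pow[of b] sets.space_closed[of "haar b"] by (intro sets_measure_of) blast
  finally show ?thesis .
qed

section \<open>The tilted measures\<close>

locale weighted_cascade =
  fixes b :: nat and P :: "(nat list \<Rightarrow> real) measure"
    and F :: "nat list \<Rightarrow> (nat list \<Rightarrow> real) \<Rightarrow> real"
  assumes b_pos: "b > 0"
    and prob_P: "prob_space P"
    and sets_P: "sets P = sets (weight_space b)"
    and weights: "weight_system b P F"
    and root_mass_pos: "root_mass P F > 0"
begin

sublocale prob_space P by (rule prob_P)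

lemma space_P: "space P = space (weight_space b)"
  using sets_P by (rule sets_eq_imp_space_eq)

lemma subalgebra_level: "subalgebra P (level_algebra b n)"
  using sets_level_subset_weight by (auto simp: subalgebra_def space_P sets_P space_level_algebra)

lemma level_sets_in_P: "A \<in> sets (level_algebra b n) \<Longrightarrow> A \<in> sets P"
  using subalgebra_level by (auto simp: subalgebra_def)

lemma martingale_weight_density:
  "t \<in> space (haar b) \<Longrightarrow> martingale P (level_algebra b) (\<lambda>n. weight_density F n t)"
  using weights by (simp add: weight_system_def positive_T_martingale_def)

lemma weight_density_nonneg:
  "t \<in> space (haar b) \<Longrightarrow> \<omega> \<in> space P \<Longrightarrow> 0 \<le> weight_density F n t \<omega>"
  using weights by (simp add: weight_system_def positive_T_martingale_def)

lemma integrable_weight_density: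
  "t \<in> space (haar b) \<Longrightarrow> integrable P (weight_density F n t)"
  using martingale_weight_density by (simp add: martingale_def)

lemma measurable_weight_density:
  "t \<in> space (haar b) \<Longrightarrow> weight_density F n t \<in> borel_measurable (level_algebra b n)"
  using martingale_weight_density by (simp add: martingale_def)

text \<open>For \<open>A \<in> \<F>\<^sub>n\<close> and \<open>w = t|n\<close> this is \<open>P\<^sub>F\<^sub>,\<^sub>t(A)\<close>, as \<open>emeasure_tilted_measure\<close> shows. It is kept as a real function of the word, so
  that it can be summed over the words of length \<open>n\<close>.\<close>
definition word_tilt :: "nat list \<Rightarrow> (nat list \<Rightarrow> real) set \<Rightarrow> real" where
  "word_tilt w A = inverse (root_mass P F) * (\<integral>\<omega>. indicator A \<omega> * path_density F w \<omega> \<partial>P)"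

lemma word_tilt_restr:
  "word_tilt (restr t n) A =
    inverse (root_mass P F) * (\<integral>\<omega>. indicator A \<omega> * weight_density F n t \<omega> \<partial>P)"
  by (simp add: word_tilt_def weight_density_eq_path_density)

definition level_tilt :: "nat \<Rightarrow> (nat \<Rightarrow> nat) \<Rightarrow> (nat list \<Rightarrow> real) measure" where
  "level_tilt n t = density P (\<lambda>\<omega>. ennreal (inverse (root_mass P F) * weight_density F n t \<omega>))"

lemma emeasure_level_tilt:
  assumes t: "t \<in> space (haar b)" and A: "A \<in> sets P"
  shows "emeasure (level_tilt n t) A = ennreal (word_tilt (restr t n) A)"
proof -
  have "emeasure (level_tilt n t) A =
      (\<integral>\<^sup>+\<omega>. ennreal (inverse (root_mass P F) * weight_density F n t \<omega>) * indicator A \<omega> \<partial>P)"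
    unfolding level_tilt_def using integrable_weight_density[OF t, of n] A
    by (intro emeasure_density) auto
  also have "\<dots> = (\<integral>\<^sup>+\<omega>. ennreal (inverse (root_mass P F) *
      (indicator A \<omega> * weight_density F n t \<omega>)) \<partial>P)"
    by (intro nn_integral_cong) (auto simp: indicator_def)
  also have "\<dots> = ennreal (\<integral>\<omega>. inverse (root_mass P F) *
      (indicator A \<omega> * weight_density F n t \<omega>) \<partial>P)"
    using integrable_mult_indicator[OF A integrable_weight_density[OF t, of n]]
      weight_density_nonneg[OF t] root_mass_pos
    by (intro nn_integral_eq_integral) auto
  finally show ?thesis by (simp add: word_tilt_restr)
qed

text \<open>The defining property of the conditional expectation: on sets of \<open>\<F>\<^sub>m\<close>, the later density
  integrates like its projection to \<open>\<F>\<^sub>m\<close>, which the martingale property identifies as the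
  earlier density.\<close>
lemma word_tilt_consistent:
  assumes t: "t \<in> space (haar b)" and "m \<le> n" and A: "A \<in> sets (level_algebra b m)"
  shows "word_tilt (restr t n) A = word_tilt (restr t m) A"
proof -
  interpret finite_measure_subalgebra P "level_algebra b m"
    by unfold_locales (rule subalgebra_level)
  have A': "A \<in> sets P" using A by (rule level_sets_in_P)
  have "AE \<omega> in P. real_cond_exp P (level_algebra b m) (weight_density F n t) \<omega> =
      weight_density F m t \<omega>"
    using martingale_weight_density[OF t] \<open>m \<le> n\<close> by (simp add: martingale_def)
  then have "(\<integral>\<omega>\<in>A. real_cond_exp P (level_algebra b m) (weight_density F n t) \<omega> \<partial>P) =
      (\<integral>\<omega>\<in>A. weight_density F m t \<omega> \<partial>P)"
    unfolding set_lebesgue_integral_def using A' integrable_weight_density[OF t, of m]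
    by (intro integral_cong_AE) auto
  then show ?thesis
    using real_cond_exp_intA[OF integrable_weight_density[OF t, of n] A]
    by (simp add: word_tilt_restr set_lebesgue_integral_def)
qed

text \<open>By consistency the total mass is that at level \<open>0\<close>, where the density integrates to the root
  mass.\<close>
lemma prob_space_level_tilt:
  assumes t: "t \<in> space (haar b)"
  shows "prob_space (level_tilt n t)"
proof
  have top: "space P \<in> sets (level_algebra b 0)"
    using sets.top[of "level_algebra b 0"] by (simp add: space_level_algebra space_P)
  have "word_tilt (restr t n) (space P) = word_tilt (restr t 0) (space P)"
    using word_tilt_consistent[OF t _ top] by simp
  also have "(\<integral>\<omega>. indicator (space P) \<omega> * weight_density F 0 t \<omega> \<partial>P) = root_mass P F"
    unfolding root_mass_def by (rule Bochner_Integration.integral_cong)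
      (auto simp: weight_density_def restr_def)
  then have "word_tilt (restr t 0) (space P) = 1"
    using root_mass_pos by (simp add: word_tilt_restr)
  finally show "emeasure (level_tilt n t) (space (level_tilt n t)) = 1"
    using emeasure_level_tilt[OF t, of "space P" n] by (simp add: level_tilt_def)
qed

text \<open>The equality of measures restricted to \<open>\<F>\<^sub>n\<close> in the definition, in the form in which
  the extension result produces it.\<close>
lemma is_tilted_measure_iff:
  assumes t: "t \<in> space (haar b)"
  shows "is_tilted_measure b P F t R \<longleftrightarrow>
    prob_space R \<and> sets R = sets (weight_space b) \<and>
    (\<forall>n. \<forall>A\<in>sets (level_algebra b n). emeasure R A = emeasure (level_tilt n t) A)"
proof -
  let ?g = "\<lambda>n \<omega>. ennreal (inverse (root_mass P F) * weight_density F n t \<omega>)"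
  have "restr_to_subalg R (level_algebra b n) = density (restr_to_subalg P (level_algebra b n)) (?g n)
      \<longleftrightarrow> (\<forall>A\<in>sets (level_algebra b n). emeasure R A = emeasure (level_tilt n t) A)"
    (is "?l = ?r \<longleftrightarrow> _") if sR: "sets R = sets (weight_space b)" for n
  proof -
    have subR: "subalgebra R (level_algebra b n)"
      using subalgebra_level sets_eq_imp_space_eq[OF sR]
      by (simp add: subalgebra_def space_P sets_P sR)
    have sets_l: "sets ?l = sets (level_algebra b n)"
      by (rule sets_restr_to_subalg[OF subR])
    have sets_r: "sets ?r = sets (level_algebra b n)"
      by (simp add: sets_restr_to_subalg[OF subalgebra_level])
    have gF: "?g n \<in> borel_measurable (level_algebra b n)"
      using measurable_weight_density[OF t, of n] by measurable
    have "emeasure ?r A = emeasure (level_tilt n t) A" if A: "A \<in> sets (level_algebra b n)" for A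
    proof -
      have "emeasure ?r A = (\<integral>\<^sup>+\<omega>. ?g n \<omega> * indicator A \<omega> \<partial>restr_to_subalg P (level_algebra b n))"
        using A gF
        by (intro emeasure_density)
          (auto simp: sets_restr_to_subalg[OF subalgebra_level]
            intro: measurable_in_subalg[OF subalgebra_level])
      also have "\<dots> = (\<integral>\<^sup>+\<omega>. ?g n \<omega> * indicator A \<omega> \<partial>P)"
        using A gF by (intro nn_integral_subalgebra2[OF subalgebra_level]) auto
      also have "\<dots> = emeasure (level_tilt n t) A"
        unfolding level_tilt_def using A gF subalgebra_level
        by (intro emeasure_density[symmetric])
          (auto simp: subalgebra_def intro: measurable_from_subalg[OF subalgebra_level])
      finally show ?thesis .
    qed
    moreover have "emeasure ?l A = emeasure R A" if "A \<in> sets (level_algebra b n)" for A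
      using emeasure_restr_to_subalg[OF subR that] .
    ultimately show ?thesis
      using sets_l sets_r by (auto intro!: measure_eqI)
  qed
  then show ?thesis
    unfolding is_tilted_measure_def has_level_densities_def by blast
qed

lemma ex1_tilted_measure:
  assumes t: "t \<in> space (haar b)"
  shows "\<exists>!R. is_tilted_measure b P F t R"
  unfolding is_tilted_measure_iff[OF t]
proof (rule level_consistent_extension)
  fix m n A assume "m \<le> n" "A \<in> sets (level_algebra b m)"
  then show "emeasure (level_tilt n t) A = emeasure (level_tilt m t) A"
    using word_tilt_consistent[OF t] emeasure_level_tilt[OF t level_sets_in_P] by simp
qed (use prob_space_level_tilt[OF t] sets_P in \<open>auto simp: level_tilt_def\<close>)

lemma is_tilted_measure_tilted_measure:
  "t \<in> space (haar b) \<Longrightarrow> is_tilted_measure b P F t (tilted_measure b P F t)"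
  unfolding tilted_measure_def by (rule theI') (rule ex1_tilted_measure)

lemma
  assumes t: "t \<in> space (haar b)"
  shows prob_space_tilted_measure: "prob_space (tilted_measure b P F t)"
    and sets_tilted_measure: "sets (tilted_measure b P F t) = sets (weight_space b)"
  using is_tilted_measure_tilted_measure[OF t] by (simp_all add: is_tilted_measure_def)

lemma emeasure_tilted_measure:
  assumes t: "t \<in> space (haar b)" and A: "A \<in> sets (level_algebra b n)"
  shows "emeasure (tilted_measure b P F t) A = ennreal (word_tilt (restr t n) A)"
  using is_tilted_measure_tilted_measure[OF t] emeasure_level_tilt[OF t level_sets_in_P[OF A]] A
  by (simp add: is_tilted_measure_iff[OF t])

section \<open>The disintegration\<close>

text \<open>On each set of \<open>\<F>\<^sub>n\<close> the kernel is a function of \<open>t|n\<close>, which takes values in a countable discrete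
  space, and every function on such a space is measurable.\<close>
lemma measurable_tilted_measure:
  "tilted_measure b P F \<in> measurable (haar b) (prob_algebra (weight_space b))"
proof (rule measurable_prob_algebra_generated[OF sets_weight_generated Int_stable_levels levels_subset_Pow])
  fix A assume "A \<in> (\<Union>n. sets (level_algebra b n))"
  then obtain n where A: "A \<in> sets (level_algebra b n)" by blast
  have "(\<lambda>t. ennreal (word_tilt (restr t n) A)) \<in> borel_measurable (haar b)"
    by (rule measurable_compose[OF measurable_restr]) simp
  then show "(\<lambda>t. emeasure (tilted_measure b P F t) A) \<in> borel_measurable (haar b)"
    by (subst measurable_cong[OF emeasure_tilted_measure[OF _ A]]) (simp_all)
qed (use prob_space_tilted_measure sets_tilted_measure in auto)

text \<open>With \<open>[w]\<close> for the cylinder below \<open>w\<close>, both sides equal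
  \<open>\<Sum>\<^sub>w \<lambda>(B \<inter> [w]) word_tilt w A\<close>, the sum running over the words of length \<open>n\<close>: on the
  left the inner integral over the boundary is evaluated cylinder by cylinder under the expectation,
  on the right the integrand is constant on each cylinder.\<close>
lemma weighted_measure_rectangle:
  assumes Q: "is_weighted_measure b P F \<Q>"
    and A: "A \<in> sets (level_algebra b n)" and B: "B \<in> sets (haar b)"
  shows "emeasure \<Q> (A \<times> B) =
    (\<integral>\<^sup>+t. emeasure (tilted_measure b P F t) A * indicator B t \<partial>haar b)"
proof -
  interpret Q: prob_space \<Q> using Q by (simp add: is_weighted_measure_def)
  interpret haar: prob_space "haar b" using b_pos by (rule prob_space_haar)
  let ?W = "words_of_length b n"
  let ?c = "\<lambda>w. measure (haar b) (B \<inter> ((\<lambda>t. restr t n) -` {w} \<inter> space (haar b)))"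
  have A_P: "A \<in> sets P" using A by (rule level_sets_in_P)
  have AB: "A \<times> B \<in> sets \<Q>"
    using Q A_P B by (auto simp: is_weighted_measure_def sets_P)
  have f: "indicator (A \<times> B) \<in> borel_measurable (level_algebra b n \<Otimes>\<^sub>M haar b)"
    using A B by (intro borel_measurable_indicator) auto
  have bdd: "\<exists>C. \<forall>z\<in>space (weight_space b \<Otimes>\<^sub>M haar b). \<bar>indicator (A \<times> B) z :: real\<bar> \<le> C"
    by (intro exI[of _ 1]) (auto simp: indicator_def)
  have integrable_path: "integrable P (\<lambda>\<omega>. indicator A \<omega> * path_density F w \<omega>)" if w: "w \<in> ?W" for w
  proof -
    obtain t where "t \<in> space (haar b)" "restr t n = w"
      using word_is_restr[OF b_pos w] by blast
    then show ?thesis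
      using integrable_mult_indicator[OF A_P integrable_weight_density[of t n]]
      by (simp add: weight_density_eq_path_density)
  qed
  have "measure \<Q> (A \<times> B) = (\<integral>z. indicator (A \<times> B) z \<partial>\<Q>)"
    using AB sets.sets_into_space[OF AB] by (simp add: Int_absorb2)
  also have "\<dots> = inverse (root_mass P F) *
      (\<integral>\<omega>. (\<integral>t. indicator (A \<times> B) (\<omega>, t) * weight_density F n t \<omega> \<partial>haar b) \<partial>P)"
    using Q f bdd unfolding is_weighted_measure_def by blast
  also have "(\<lambda>\<omega>. \<integral>t. indicator (A \<times> B) (\<omega>, t) * weight_density F n t \<omega> \<partial>haar b) =
      (\<lambda>\<omega>. \<Sum>w\<in>?W. indicator A \<omega> * path_density F w \<omega> * ?c w)"
  proof
    fix \<omega>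
    show "(\<integral>t. indicator (A \<times> B) (\<omega>, t) * weight_density F n t \<omega> \<partial>haar b) =
        (\<Sum>w\<in>?W. indicator A \<omega> * path_density F w \<omega> * ?c w)"
      using has_bochner_integral_integral_eq[OF has_integral_over_cylinders[OF b_pos B,
            of "\<lambda>w. indicator A \<omega> * path_density F w \<omega>" n]]
      by (simp add: indicator_times weight_density_eq_path_density ac_simps)
  qed
  also have "inverse (root_mass P F) *
      (\<integral>\<omega>. (\<Sum>w\<in>?W. indicator A \<omega> * path_density F w \<omega> * ?c w) \<partial>P) =
      (\<Sum>w\<in>?W. word_tilt w A * ?c w)"
  proof -
    have "(\<integral>\<omega>. (\<Sum>w\<in>?W. indicator A \<omega> * path_density F w \<omega> * ?c w) \<partial>P) =
        (\<Sum>w\<in>?W. (\<integral>\<omega>. indicator A \<omega> * path_density F w \<omega> \<partial>P) * ?c w)"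
      using integrable_path
      by (subst Bochner_Integration.integral_sum) (auto intro!: sum.cong integral_mult_left_zero)
    then show ?thesis
      by (simp add: word_tilt_def sum_distrib_left mult.assoc)
  qed
  also have "\<dots> = (\<integral>t. indicator B t * word_tilt (restr t n) A \<partial>haar b)"
    by (rule has_bochner_integral_integral_eq[OF has_integral_over_cylinders[OF b_pos B, of "\<lambda>w. word_tilt w A" n], symmetric])
  finally have "emeasure \<Q> (A \<times> B) = ennreal \<dots>"
    by (simp add: Q.emeasure_eq_measure)
  also have "\<dots> = (\<integral>\<^sup>+t. ennreal (indicator B t * word_tilt (restr t n) A) \<partial>haar b)"
  proof (rule nn_integral_eq_integral[symmetric])
    show "integrable (haar b) (\<lambda>t. indicator B t * word_tilt (restr t n) A)"
      using has_integral_over_cylinders[OF b_pos B, of "\<lambda>w. word_tilt w A" n]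
      by (simp add: has_bochner_integral_iff)
    have "0 \<le> word_tilt (restr t n) A" if "t \<in> space (haar b)" for t
      unfolding word_tilt_restr
      using weight_density_nonneg[OF that] root_mass_pos
      by (intro mult_nonneg_nonneg Bochner_Integration.integral_nonneg) auto
    then show "AE t in haar b. 0 \<le> indicator B t * word_tilt (restr t n) A" by simp
  qed
  also have "\<dots> = (\<integral>\<^sup>+t. emeasure (tilted_measure b P F t) A * indicator B t \<partial>haar b)"
    using emeasure_tilted_measure[OF _ A]
    by (intro nn_integral_cong) (auto simp: indicator_def)
  finally show ?thesis .
qed

text \<open>The right-hand side of the disintegration is the measure of the mixture \<open>\<integral> P\<^sub>F\<^sub>,\<^sub>t \<otimes> \<delta>\<^sub>t \<lambda>(dt)\<close>,
  formed with the Giry monad. Once it is known to be a measure, equality on the generating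
  rectangles suffices.\<close>
lemma disintegrates_weighted_measure:
  assumes Q: "is_weighted_measure b P F \<Q>"
  shows "disintegrates \<Q> (weight_space b) (tilted_measure b P F) (haar b)"
proof -
  interpret Q: prob_space \<Q> using Q by (simp add: is_weighted_measure_def)
  interpret haar: prob_space "haar b" using b_pos by (rule prob_space_haar)
  let ?K = "tilted_measure b P F" and ?N = "weight_space b \<Otimes>\<^sub>M haar b"
  let ?E = "{A \<times> B | A B. A \<in> (\<Union>n. sets (level_algebra b n)) \<and> B \<in> sets (haar b)}"
  define kernel where "kernel t = distr (?K t) ?N (\<lambda>\<omega>. (\<omega>, t))" for t
  have kernel: "kernel \<in> measurable (haar b) (subprob_algebra ?N)"
    unfolding kernel_def
    by (rule measurable_distr2[OF _ measurable_prob_algebraD[OF measurable_tilted_measure]]) simp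
  have emeasure_kernel: "emeasure (kernel t) X = emeasure (?K t) {\<omega> \<in> space (weight_space b). (\<omega>, t) \<in> X}"
    if t: "t \<in> space (haar b)" and X: "X \<in> sets ?N" for t X
  proof -
    have "(\<lambda>\<omega>. (\<omega>, t)) \<in> measurable (?K t) ?N"
      using t by (simp add: measurable_cong_sets[OF sets_tilted_measure[OF t] refl])
    then have "emeasure (kernel t) X = emeasure (?K t) ((\<lambda>\<omega>. (\<omega>, t)) -` X \<inter> space (?K t))"
      unfolding kernel_def using X by (rule emeasure_distr)
    also have "(\<lambda>\<omega>. (\<omega>, t)) -` X \<inter> space (?K t) = {\<omega> \<in> space (weight_space b). (\<omega>, t) \<in> X}"
      using sets_eq_imp_space_eq[OF sets_tilted_measure[OF t]] by auto
    finally show ?thesis .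
  qed
  define mixture where "mixture = haar b \<bind> kernel"
  have mixture: "emeasure mixture X =
      (\<integral>\<^sup>+t. emeasure (?K t) {\<omega> \<in> space (weight_space b). (\<omega>, t) \<in> X} \<partial>haar b)"
    if X: "X \<in> sets ?N" for X
    unfolding mixture_def emeasure_bind[OF haar.not_empty kernel X]
    by (intro nn_integral_cong emeasure_kernel X)
  have "\<Q> = mixture"
  proof (rule measure_eqI_generator_eq)
    show "Int_stable ?E"
    proof (rule Int_stableI)
      fix X Y assume "X \<in> ?E" "Y \<in> ?E"
      then obtain A B C D where X: "X = A \<times> B" and Y: "Y = C \<times> D"
        and A: "A \<in> (\<Union>n. sets (level_algebra b n))" and C: "C \<in> (\<Union>n. sets (level_algebra b n))"
        and B: "B \<in> sets (haar b)" and D: "D \<in> sets (haar b)" by blast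
      have "X \<inter> Y = (A \<inter> C) \<times> (B \<inter> D)" by (simp add: X Y Times_Int_Times)
      moreover have "A \<inter> C \<in> (\<Union>n. sets (level_algebra b n))"
        using Int_stable_levels A C by (rule Int_stableD)
      moreover have "B \<inter> D \<in> sets (haar b)" using B D by (rule sets.Int)
      ultimately show "X \<inter> Y \<in> ?E" by blast
    qed
    show "?E \<subseteq> Pow (space (weight_space b) \<times> space (haar b))"
      using levels_subset_Pow[of b] sets.space_closed[of "haar b"] by blast
    show "sets \<Q> = sigma_sets (space (weight_space b) \<times> space (haar b)) ?E"
      using Q by (simp add: is_weighted_measure_def sets_pair_generated)
    show "sets mixture = sigma_sets (space (weight_space b) \<times> space (haar b)) ?E"
      unfolding mixture_def sets_pair_generated[symmetric]
      by (rule sets_bind) (simp_all add: kernel_def haar.not_empty)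
    fix X assume "X \<in> ?E"
    then obtain n A B where X: "X = A \<times> B"
      and A: "A \<in> sets (level_algebra b n)" and B: "B \<in> sets (haar b)" by blast
    have A_space: "A \<in> sets (weight_space b)"
      using A sets_level_subset_weight by blast
    have "emeasure mixture (A \<times> B) =
        (\<integral>\<^sup>+t. emeasure (?K t) {\<omega> \<in> space (weight_space b). (\<omega>, t) \<in> A \<times> B} \<partial>haar b)"
      using A_space B by (intro mixture) simp
    also have "\<dots> = (\<integral>\<^sup>+t. emeasure (?K t) A * indicator B t \<partial>haar b)"
    proof (intro nn_integral_cong)
      fix t
      have "{\<omega> \<in> space (weight_space b). (\<omega>, t) \<in> A \<times> B} = (if t \<in> B then A else {})"
        using sets.sets_into_space[OF A_space] by auto
      then show "emeasure (?K t) {\<omega> \<in> space (weight_space b). (\<omega>, t) \<in> A \<times> B} =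
          emeasure (?K t) A * indicator B t" by simp
    qed
    also have "\<dots> = emeasure \<Q> (A \<times> B)"
      by (rule weighted_measure_rectangle[OF Q A B, symmetric])
    finally show "emeasure \<Q> X = emeasure mixture X" by (simp add: X)
  next
    show "range (\<lambda>_::nat. space (weight_space b) \<times> space (haar b)) \<subseteq> ?E"
      using sets.top[of "level_algebra b 0"] sets.top[of "haar b"]
      unfolding space_level_algebra by blast
    show "(\<Union>i::nat. space (weight_space b) \<times> space (haar b)) = space (weight_space b) \<times> space (haar b)"
      by simp
    show "emeasure \<Q> (space (weight_space b) \<times> space (haar b)) \<noteq> \<infinity>" by simp
  qed
  then show ?thesis
    using mixture measurable_tilted_measure Q
    by (simp add: disintegrates_def is_weighted_measure_def)
qed

end

theorem theorem2p2:
  fixes b :: nat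
    and p0 :: "real measure"
    and q :: "nat \<Rightarrow> (nat \<Rightarrow> real) \<Rightarrow> real measure"
    and P :: "(nat list \<Rightarrow> real) measure"
    and F :: "nat list \<Rightarrow> (nat list \<Rightarrow> real) \<Rightarrow> real"
    and \<Q> :: "((nat list \<Rightarrow> real) \<times> (nat \<Rightarrow> nat)) measure"
  assumes "b \<ge> 2"
    and "cascade_generator b p0 q P"
    and "weight_system b P F"
    and "root_mass P F > 0"
    and "is_weighted_measure b P F \<Q>"
  shows "(\<forall>t\<in>space (haar b). \<exists>!R. is_tilted_measure b P F t R) \<and>
    disintegrates \<Q> (weight_space b) (tilted_measure b P F) (haar b)"
proof -
  interpret weighted_cascade b P F
  proof (rule weighted_cascade.intro)
    show "prob_space P" "sets P = sets (weight_space b)"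
      using assms(2) by (simp_all only: cascade_generator_def)
  qed (use assms(1,3,4) in simp_all)
  show ?thesis
    by (intro conjI ballI ex1_tilted_measure disintegrates_weighted_measure assms(5))
qed

end
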